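(* A scattered topological space $X$ of finite scattered height $\hbar[X]$ is stratifiable if and only if for every $n<\hbar[X]$ the set $X^{[n]}$ is a $G_\delta$-retract in $X$.
   Context: A point $x$ of a space $A$ is isolated in $A$ if $\{x\}$ is clopen in $A$; $A'$ denotes the set of non-isolated points of the space $A$. A space is scattered if each non-empty subspace of it contains an isolated point. Put $X^{[0]}=X$ and $X^{[\alpha]}=\bigcap_{\beta<\alpha}(X^{[\beta]})'$ for ordinals $\alpha>0$; the scattered height $\hbar[X]$ is the smallest ordinal $\alpha$ with $X^{[\alpha]}=X^{[\alpha+1]}$. A subset $A\subset X$ is a retract of $X$ if there is a continuous map $r:X\to A$ with $r(a)=a$ for all $a\in A$; it is a $G_\delta$-retract if moreover $A$ is a $G_\delta$-subset of $X$. A regular space $X$ (regular spaces are understood to be $T_1$) is stratifiable if to each $x\in X$ one can assign a decreasing sequence $(U_n(x))_{n\in\omega}$ of neighborhoods of $x$ such that each closed set $F\subset X$ equals $\bigcap_{n\in\omega}\overline{U_n[F]}$, where $U_n[F]=\bigcup_{x\in F}U_n(x)$. *)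

theory Defs
  imports "HOL-Analysis.Analysis"
begin

definition isolated_point :: "'a topology \<Rightarrow> 'a \<Rightarrow> bool" where
  "isolated_point A x \<longleftrightarrow> x \<in> topspace A \<and> openin A {x} \<and> closedin A {x}"

definition nonisolated_points :: "'a topology \<Rightarrow> 'a set" where
  "nonisolated_points A = {x \<in> topspace A. \<not> isolated_point A x}"

text \<open>Since isolated points are required to have clopen singletons, a scattered space
  is automatically \<open>T\<^sub>1\<close> (apply the definition to two-point subspaces).\<close>

definition scattered_space :: "'a topology \<Rightarrow> bool" where
  "scattered_space X \<longleftrightarrow>
     (\<forall>S. S \<subseteq> topspace X \<and> S \<noteq> {} \<longrightarrow> (\<exists>x. isolated_point (subtopology X S) x))"

text \<open>The derivatives \<open>X\<^sup>[\<^sup>\<alpha>\<^sup>]\<close> are defined for finite \<open>\<alpha>\<close> only: the least ordinal at which the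
  transfinite sequence is stationary is finite iff the sequence of finite stages has a
  stationary index, and it is then the least such index.\<close>

function cb_derivative :: "'a topology \<Rightarrow> nat \<Rightarrow> 'a set" where
  "cb_derivative X n =
     (if n = 0 then topspace X
      else (\<Inter>k\<in>{..<n}. nonisolated_points (subtopology X (cb_derivative X k))))"
  by auto
termination
  by (relation "Wellfounded.measure snd") auto

declare cb_derivative.simps [simp del]

definition finite_scattered_height :: "'a topology \<Rightarrow> bool" where
  "finite_scattered_height X \<longleftrightarrow> (\<exists>n. cb_derivative X n = cb_derivative X (Suc n))"

text \<open>Only meaningful if \<open>finite_scattered_height X\<close> holds.\<close>

definition scattered_height :: "'a topology \<Rightarrow> nat" where
  "scattered_height X = (LEAST n. cb_derivative X n = cb_derivative X (Suc n))"

definition gdelta_retract :: "'a topology \<Rightarrow> 'a set \<Rightarrow> bool" where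
  "gdelta_retract X A \<longleftrightarrow> A retract_of_space X \<and> gdelta_in X A"

text \<open>Neighborhoods need not be open.\<close>

definition neighborhood_in :: "'a topology \<Rightarrow> 'a \<Rightarrow> 'a set \<Rightarrow> bool" where
  "neighborhood_in X x N \<longleftrightarrow> N \<subseteq> topspace X \<and> (\<exists>V. openin X V \<and> x \<in> V \<and> V \<subseteq> N)"

definition stratifiable_space :: "'a topology \<Rightarrow> bool" where
  "stratifiable_space X \<longleftrightarrow> regular_space X \<and> t1_space X \<and>
     (\<exists>U :: nat \<Rightarrow> 'a \<Rightarrow> 'a set.
        (\<forall>x\<in>topspace X. \<forall>n. neighborhood_in X x (U n x) \<and> U (Suc n) x \<subseteq> U n x) \<and>
        (\<forall>F. closedin X F \<longrightarrow> F = (\<Inter>n. X closure_of (\<Union>x\<in>F. U n x))))"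

end

theory Submission
  imports Defs
begin

text \<open>
  By induction on the height, stratifiability is lifted from \<open>A = X\<^sup>[\<^sup>1\<^sup>]\<close> to \<open>X\<close> by \<open>U\<^sub>n(x) = r\<^sup>-\<^sup>1(V\<^sub>n(x)) \<inter> W\<^sub>n\<close>, where
  \<open>V\<close> stratifies \<open>A = \<Inter>\<^sub>n W\<^sub>n\<close> and \<open>r\<close> is the retraction, and by \<open>U\<^sub>n(x) = {x}\<close> off \<open>A\<close>.
  Conversely, if \<open>U\<close> stratifies \<open>X\<close> and \<open>A\<close> is closed with isolated complement, a retraction
  onto \<open>A\<close> sends \<open>x \<notin> A\<close> to some \<open>b \<in> A\<close> with \<open>x \<in> U\<^sub>m(b)\<close>, for the largest possible \<open>m\<close>;
  this maximum exists because \<open>x \<notin> closure U\<^sub>k[A]\<close> for some \<open>k\<close>.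
\<close>

section \<open>Neighborhoods and stratifications\<close>

lemma neighborhood_in_mem: "neighborhood_in X x N \<Longrightarrow> x \<in> N"
  by (auto simp: neighborhood_in_def)

lemma neighborhood_in_singleton: "openin X {x} \<Longrightarrow> neighborhood_in X x {x}"
  unfolding neighborhood_in_def using openin_subset by fastforce

lemma neighborhood_in_subtopology:
  assumes "neighborhood_in X x N" "x \<in> S"
  shows "neighborhood_in (subtopology X S) x (N \<inter> S)"
proof -
  obtain V where "N \<subseteq> topspace X" "openin X V" "x \<in> V" "V \<subseteq> N"
    using assms unfolding neighborhood_in_def by blast
  then have "openin (subtopology X S) (V \<inter> S)" "x \<in> V \<inter> S" "V \<inter> S \<subseteq> N \<inter> S"
      "N \<inter> S \<subseteq> topspace (subtopology X S)"
    using assms by (auto simp: openin_subtopology)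
  then show ?thesis
    unfolding neighborhood_in_def by blast
qed

text \<open>A working form of the sequences in \<open>stratifiable_space\<close>: monotonicity is
  stated for arbitrary indices, and the equation for \<open>F\<close> is replaced by its nontrivial
  inclusion, the separation of points from closed sets. The other inclusion follows from
  \<open>x \<in> U n x\<close>.\<close>

definition stratification :: "'a topology \<Rightarrow> (nat \<Rightarrow> 'a \<Rightarrow> 'a set) \<Rightarrow> bool" where
  "stratification X U \<longleftrightarrow>
     (\<forall>x\<in>topspace X. \<forall>n. neighborhood_in X x (U n x)) \<and>
     (\<forall>x\<in>topspace X. \<forall>m n. m \<le> n \<longrightarrow> U n x \<subseteq> U m x) \<and>
     (\<forall>F y. closedin X F \<and> y \<notin> F \<longrightarrow> (\<exists>n. y \<notin> X closure_of (\<Union>x\<in>F. U n x)))"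

lemma
  assumes "stratification X U"
  shows stratification_nbhd: "x \<in> topspace X \<Longrightarrow> neighborhood_in X x (U n x)"
    and stratification_antimono: "x \<in> topspace X \<Longrightarrow> m \<le> n \<Longrightarrow> U n x \<subseteq> U m x"
    and stratification_separates:
      "closedin X F \<Longrightarrow> y \<notin> F \<Longrightarrow> \<exists>n. y \<notin> X closure_of (\<Union>x\<in>F. U n x)"
  using assms by (simp_all add: stratification_def)

lemma stratifiable_imp_stratification:
  fixes X :: "'a topology"
  assumes "stratifiable_space X"
  shows "\<exists>U. stratification X U"
proof -
  obtain U :: "nat \<Rightarrow> 'a \<Rightarrow> 'a set" where
    nbhd: "\<forall>x\<in>topspace X. \<forall>n. neighborhood_in X x (U n x) \<and> U (Suc n) x \<subseteq> U n x"
    and closed: "\<forall>F. closedin X F \<longrightarrow> F = (\<Inter>n. X closure_of (\<Union>x\<in>F. U n x))"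
    using assms unfolding stratifiable_space_def by (elim conjE exE)
  have "U n x \<subseteq> U m x" if "x \<in> topspace X" "m \<le> n" for x m n
    using lift_Suc_antimono_le [of "\<lambda>n. U n x"] nbhd that by simp
  moreover have "\<exists>n. y \<notin> X closure_of (\<Union>x\<in>F. U n x)" if "closedin X F" "y \<notin> F" for F y
    using closed that by blast
  ultimately have "stratification X U"
    using nbhd by (simp add: stratification_def)
  then show ?thesis
    by (rule exI [of _ U])
qed

text \<open>Regularity follows from separation: if \<open>y\<close> is outside the closure of
  \<open>\<Union>x\<in>F. U n x\<close>, then any open \<open>V\<close> between \<open>F\<close> and
  that union, together with the complement of the closure of \<open>V\<close>, separates
  \<open>F\<close> from \<open>y\<close>.\<close>

lemma stratifiable_spaceI:
  fixes X :: "'a topology" and U :: "nat \<Rightarrow> 'a \<Rightarrow> 'a set"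
  assumes "t1_space X"
    and nbhd: "\<And>x n. x \<in> topspace X \<Longrightarrow> neighborhood_in X x (U n x)"
    and dec: "\<And>x n. x \<in> topspace X \<Longrightarrow> U (Suc n) x \<subseteq> U n x"
    and sep: "\<And>F y. closedin X F \<Longrightarrow> y \<in> topspace X - F \<Longrightarrow>
                \<exists>n. y \<notin> X closure_of (\<Union>x\<in>F. U n x)"
  shows "stratifiable_space X"
proof -
  \<comment> \<open>The sets \<open>U n x\<close> need not be open, so an open neighborhood is
    chosen inside each of them.\<close>
  have open_hull: "\<exists>V. openin X V \<and> F \<subseteq> V \<and> V \<subseteq> (\<Union>x\<in>F. U n x)" if "closedin X F" for F n
  proof -
    have "\<forall>x\<in>F. \<exists>V. openin X V \<and> x \<in> V \<and> V \<subseteq> U n x"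
      using nbhd closedin_subset [OF that] unfolding neighborhood_in_def by blast
    from bchoice [OF this] obtain V
      where "\<forall>x\<in>F. openin X (V x) \<and> x \<in> V x \<and> V x \<subseteq> U n x" ..
    then show ?thesis
      by (intro exI [of _ "\<Union>x\<in>F. V x"] conjI openin_Union) auto
  qed
  have "regular_space X"
    unfolding regular_space_def
  proof clarify
    fix F y assume F: "closedin X F" and y: "y \<in> topspace X" "y \<notin> F"
    then obtain n where n: "y \<notin> X closure_of (\<Union>x\<in>F. U n x)"
      using sep by blast
    obtain V where V: "openin X V" "F \<subseteq> V" "V \<subseteq> (\<Union>x\<in>F. U n x)"
      using open_hull [OF F] by blast
    have "y \<notin> X closure_of V"
      using n closure_of_mono [OF V(3)] by blast
    moreover have "openin X (topspace X - X closure_of V)"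
      by (intro openin_diff) auto
    moreover have "disjnt (topspace X - X closure_of V) V"
      using closure_of_subset [OF openin_subset [OF V(1)]] by (auto simp: disjnt_iff)
    ultimately show "\<exists>W V. openin X W \<and> openin X V \<and> y \<in> W \<and> F \<subseteq> V \<and> disjnt W V"
      using y V by (intro exI [of _ "topspace X - X closure_of V"] exI [of _ V]) simp
  qed
  moreover have "F = (\<Inter>n. X closure_of (\<Union>x\<in>F. U n x))" if F: "closedin X F" for F
  proof
    show "F \<subseteq> (\<Inter>n. X closure_of (\<Union>x\<in>F. U n x))"
    proof
      fix y assume "y \<in> F"
      then have "y \<in> topspace X \<inter> (\<Union>x\<in>F. U n x)" for n
        using closedin_subset [OF F] neighborhood_in_mem [OF nbhd, of y n] by auto
      then show "y \<in> (\<Inter>n. X closure_of (\<Union>x\<in>F. U n x))"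
        using closure_of_subset_Int [of X] by (intro INT_I) (rule subsetD)
    qed
    show "(\<Inter>n. X closure_of (\<Union>x\<in>F. U n x)) \<subseteq> F"
    proof
      fix y assume y: "y \<in> (\<Inter>n. X closure_of (\<Union>x\<in>F. U n x))"
      \<comment> \<open>The index 0 only serves to place \<open>y\<close> in the space, since
        \<open>sep\<close> speaks of points of \<open>topspace X\<close>.\<close>
      then have "y \<in> X closure_of (\<Union>x\<in>F. U 0 x)"
        by blast
      then have "y \<in> topspace X"
        by (simp add: in_closure_of)
      then show "y \<in> F"
        using sep [OF F, of y] y by auto
    qed
  qed
  ultimately show ?thesis
    unfolding stratifiable_space_def using assms(1) nbhd dec
    by (intro conjI exI [of _ U]) auto
qed

section \<open>Closed subspaces and discrete spaces\<close>

lemma stratifiable_space_closed_subtopology: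
  assumes "stratifiable_space X" "closedin X S"
  shows "stratifiable_space (subtopology X S)"
proof -
  obtain U where U: "stratification X U"
    using stratifiable_imp_stratification [OF assms(1)] by (elim exE)
  note nbhd = stratification_nbhd [OF U] and dec = stratification_antimono [OF U]
    and sep = stratification_separates [OF U]
  show ?thesis
  proof (rule stratifiable_spaceI [where U = "\<lambda>n x. U n x \<inter> S"])
    show "t1_space (subtopology X S)"
      using assms(1) by (simp add: stratifiable_space_def t1_space_subtopology)
    show "neighborhood_in (subtopology X S) x (U n x \<inter> S)"
      if "x \<in> topspace (subtopology X S)" for x n
      using that by (simp add: nbhd neighborhood_in_subtopology)
    show "U (Suc n) x \<inter> S \<subseteq> U n x \<inter> S" if "x \<in> topspace (subtopology X S)" for x n
      using that dec [of x n "Suc n"] by auto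
    fix F y assume F: "closedin (subtopology X S) F" and y: "y \<in> topspace (subtopology X S) - F"
    \<comment> \<open>As \<open>S\<close> is closed, \<open>F\<close> is closed in \<open>X\<close>
      as well, so separation in \<open>X\<close> applies; taking traces on \<open>S\<close> and
      closures in \<open>S\<close> can only shrink the closure to be avoided.\<close>
    then obtain n where "y \<notin> X closure_of (\<Union>x\<in>F. U n x)"
      using sep closedin_trans_full [OF F assms(2)] by blast
    moreover have "subtopology X S closure_of (\<Union>x\<in>F. U n x \<inter> S) \<subseteq> X closure_of (\<Union>x\<in>F. U n x)"
      by (rule order_trans [OF closure_of_subtopology_subset closure_of_mono]) blast
    ultimately show "\<exists>n. y \<notin> subtopology X S closure_of (\<Union>x\<in>F. U n x \<inter> S)"
      by blast
  qed
qed

text \<open>With singletons as neighborhoods, the hull of \<open>F\<close> is \<open>F\<close>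
  itself, which is closed. This covers the empty derivative and the last nonempty one.\<close>

lemma stratifiable_space_discrete:
  assumes "\<And>x. x \<in> topspace X \<Longrightarrow> openin X {x}"
  shows "stratifiable_space X"
proof (rule stratifiable_spaceI [where U = "\<lambda>n x. {x}"])
  show "t1_space X"
    unfolding t1_space_def
  proof (intro ballI impI)
    fix x y assume "x \<in> topspace X" "x \<noteq> y"
    then show "\<exists>U. openin X U \<and> x \<in> U \<and> y \<notin> U"
      using assms by (intro exI [of _ "{x}"]) simp
  qed
  show "\<exists>n::nat. y \<notin> X closure_of (\<Union>x\<in>F. {x})"
    if "closedin X F" "y \<in> topspace X - F" for F y
    using that by (simp add: closure_of_closedin)
qed (simp_all add: assms neighborhood_in_singleton)

section \<open>G-delta sets and retractions obtained from a stratification\<close>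

lemma stratifiable_imp_gdelta_in:
  assumes "stratifiable_space X" "closedin X F"
  shows "gdelta_in X F"
proof -
  obtain U where U: "stratification X U"
    using stratifiable_imp_stratification [OF assms(1)] by (elim exE)
  note nbhd = stratification_nbhd [OF U] and sep = stratification_separates [OF U]
  \<comment> \<open>These interiors contain \<open>F\<close>, since each \<open>U n x\<close> is a
    neighborhood of \<open>x\<close>, and they lie in the closures from \<open>sep\<close>, so their
    intersection is exactly \<open>F\<close>.\<close>
  define W where "W n = X interior_of (\<Union>x\<in>F. U n x)" for n
  have "F \<subseteq> W n" for n
  proof
    fix x assume x: "x \<in> F"
    then obtain V where "openin X V" "x \<in> V" "V \<subseteq> U n x"
      using nbhd [of x n] closedin_subset [OF assms(2)] unfolding neighborhood_in_def by blast
    then show "x \<in> W n"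
      using x unfolding W_def interior_of_def by auto
  qed
  moreover have "\<exists>n. y \<notin> W n" if "y \<notin> F" for y
  proof -
    have "W n \<subseteq> X closure_of (\<Union>x\<in>F. U n x)" for n
      unfolding W_def by (rule interior_of_subset_closure_of)
    then show ?thesis
      using sep [OF assms(2) that] by (meson subsetD)
  qed
  ultimately have "F = \<Inter> (range W)"
    by blast
  moreover have "gdelta_in X (\<Inter> (range W))"
    by (rule gdelta_in_Inter) (auto simp: W_def open_imp_gdelta_in)
  ultimately show ?thesis
    by simp
qed

text \<open>Maximality of the index makes \<open>r\<close> continuous: a point \<open>y\<close> off
  \<open>A\<close> close to \<open>x \<in> A\<close> has an index at \<open>r y\<close> at least as
  large as at \<open>x\<close>, and this keeps \<open>r y\<close> close to \<open>x\<close>.\<close>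

lemma stratifiable_imp_retract:
  assumes "stratifiable_space X" and A: "closedin X A" "A \<noteq> {}"
    and iso: "\<And>x. x \<in> topspace X - A \<Longrightarrow> openin X {x}"
  shows "A retract_of_space X"
proof -
  obtain U where U: "stratification X U"
    using stratifiable_imp_stratification [OF assms(1)] by (elim exE)
  note nbhd = stratification_nbhd [OF U] and dec = stratification_antimono [OF U]
    and sep = stratification_separates [OF U]
  have AX: "A \<subseteq> topspace X"
    using A(1) by (rule closedin_subset)
  \<comment> \<open>\<open>P x b\<close> says that no point of \<open>A\<close> beats
    \<open>b\<close> in the size of the index. Phrased without naming the maximum, it also covers
    points \<open>x\<close> in no \<open>U n a\<close>, for which every \<open>b \<in> A\<close>
    qualifies; this is where \<open>A\<close> must be nonempty.\<close>
  define P where "P x b \<longleftrightarrow> b \<in> A \<and> (\<forall>a\<in>A. \<forall>n. x \<in> U n a \<longrightarrow> (\<exists>m\<ge>n. x \<in> U m b))" for x b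
  have ex: "\<exists>b. P x b" if x: "x \<in> topspace X - A" for x
  proof (cases "\<exists>n. \<exists>a\<in>A. x \<in> U n a")
    case False
    then show ?thesis
      using A(2) unfolding P_def by blast
  next
    case True
    obtain k where k: "x \<notin> X closure_of (\<Union>a\<in>A. U k a)"
      using sep [OF A(1)] x by blast
    moreover have "topspace X \<inter> (\<Union>a\<in>A. U k a) \<subseteq> X closure_of (\<Union>a\<in>A. U k a)"
      by (rule closure_of_subset_Int)
    ultimately have "\<forall>a\<in>A. x \<notin> U k a"
      using x by blast
    \<comment> \<open>An index \<open>n > k\<close> with \<open>x \<in> U n a\<close> would give
      \<open>x \<in> U k a\<close>, as the sets decrease.\<close>
    then have bound: "n \<le> k" if "\<exists>a\<in>A. x \<in> U n a" for n
      using that dec AX by (meson linear subsetD)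
    define m where "m = (GREATEST n. \<exists>a\<in>A. x \<in> U n a)"
    have "\<exists>b\<in>A. x \<in> U m b"
      unfolding m_def using GreatestI_ex_nat [OF True] bound by blast
    moreover have "n \<le> m" if "\<exists>a\<in>A. x \<in> U n a" for n
      unfolding m_def using Greatest_le_nat [of "\<lambda>n. \<exists>a\<in>A. x \<in> U n a", OF that] bound by blast
    ultimately show ?thesis
      unfolding P_def by blast
  qed
  define r where "r x = (if x \<in> A then x else (SOME b. P x b))" for x
  have rP: "P x (r x)" if "x \<in> topspace X - A" for x
    using someI_ex [OF ex [OF that]] that by (simp add: r_def)
  have r_id: "r x = x" if "x \<in> A" for x
    using that by (simp add: r_def)
  have rA: "r x \<in> A" if "x \<in> topspace X" for x
    using rP [of x] that by (cases "x \<in> A") (auto simp: r_id P_def)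
  \<comment> \<open>Points off \<open>A\<close> have open singletons, so only points of
    \<open>A\<close> need an argument.\<close>
  have "openin X {x \<in> topspace X. r x \<in> V}" if V: "openin X V" for V
  proof (subst openin_subopen, clarify)
    fix x assume x: "x \<in> topspace X" "r x \<in> V"
    show "\<exists>T. openin X T \<and> x \<in> T \<and> T \<subseteq> {x \<in> topspace X. r x \<in> V}"
    proof (cases "x \<in> A")
      case False
      then show ?thesis
        using iso x by (intro exI [of _ "{x}"]) auto
    next
      case True
      define F where "F = topspace X - V"
      have F: "closedin X F"
        using V by (simp add: F_def openin_closedin_eq)
      have "x \<notin> F"
        using x True by (simp add: F_def r_id)
      then obtain n where n: "x \<notin> X closure_of (\<Union>z\<in>F. U n z)"
        using sep [OF F] by blast
      obtain N where N: "openin X N" "x \<in> N" "N \<subseteq> U n x"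
        using nbhd [OF x(1)] unfolding neighborhood_in_def by blast
      \<comment> \<open>The first factor controls points off \<open>A\<close>:
        \<open>y \<in> U n x\<close> forces \<open>y \<in> U n (r y)\<close>, so
        \<open>r y \<in> F\<close> would put \<open>y\<close> into the removed closure. The factor
        \<open>V\<close> controls points of \<open>A\<close>, which \<open>r\<close> fixes.\<close>
      define T where "T = (N - X closure_of (\<Union>z\<in>F. U n z)) \<inter> V"
      have "openin X T"
        unfolding T_def using N(1) V by (intro openin_Int openin_diff) auto
      moreover have "x \<in> T"
        using N n x True by (simp add: T_def r_id)
      moreover have "r y \<in> V" if y: "y \<in> T" for y
      proof (cases "y \<in> A")
        case True
        then show ?thesis
          using y by (simp add: T_def r_id)
      next
        case False
        have yX: "y \<in> topspace X"
          using y openin_subset [OF \<open>openin X T\<close>] by blast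
        have "y \<in> U n x"
          using y N(3) by (auto simp: T_def)
        \<comment> \<open>Here \<open>x\<close> itself is the competitor in
          \<open>P y (r y)\<close>.\<close>
        then obtain m where "m \<ge> n" "y \<in> U m (r y)"
          using rP [of y] yX False \<open>x \<in> A\<close> unfolding P_def by blast
        moreover have "r y \<in> topspace X"
          using rA [OF yX] AX by blast
        ultimately have "y \<in> U n (r y)"
          using dec by blast
        moreover have "y \<notin> X closure_of (\<Union>z\<in>F. U n z)"
          using y by (simp add: T_def)
        moreover have "topspace X \<inter> (\<Union>z\<in>F. U n z) \<subseteq> X closure_of (\<Union>z\<in>F. U n z)"
          by (rule closure_of_subset_Int)
        ultimately have "r y \<notin> F"
          using yX by blast
        then show ?thesis
          using \<open>r y \<in> topspace X\<close> by (simp add: F_def)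
      qed
      ultimately show ?thesis
        using openin_subset [of X T] by blast
    qed
  qed
  then have "continuous_map X X r"
    using rA AX by (auto simp: continuous_map_def)
  then have "continuous_map X (subtopology X A) r"
    using rA by (simp add: continuous_map_in_subtopology Pi_iff image_subset_iff)
  then show ?thesis
    unfolding retract_of_space_def using AX r_id by blast
qed

section \<open>Lifting a stratification along a G-delta-retract\<close>

lemma gdelta_retract_subtopology:
  assumes "gdelta_retract X A" "A \<subseteq> S"
  shows "gdelta_retract (subtopology X S) A"
proof -
  have "gdelta_in (subtopology X S) A"
    using assms unfolding gdelta_retract_def gdelta_in_subtopology by blast
  then show ?thesis
    using assms by (simp add: gdelta_retract_def retract_of_space_subtopology)
qed

lemma gdelta_retract_imp_stratifiable:
  fixes X :: "'a topology"
  assumes t1: "t1_space X" and A: "gdelta_retract X A"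
    and strat: "stratifiable_space (subtopology X A)"
    and iso: "\<And>x. x \<in> topspace X - A \<Longrightarrow> openin X {x}"
  shows "stratifiable_space X"
proof -
  have AX: "A \<subseteq> topspace X"
    using A by (simp add: gdelta_retract_def retract_of_space_def)
  then have topA: "topspace (subtopology X A) = A"
    by auto
  obtain r where r: "continuous_map X (subtopology X A) r" "\<And>x. x \<in> A \<Longrightarrow> r x = x"
    using A unfolding gdelta_retract_def retract_of_space_def by blast
  \<comment> \<open>A descending sequence is taken so that the sets \<open>U n x\<close> below
    decrease in \<open>n\<close>.\<close>
  obtain W :: "nat \<Rightarrow> 'a set" where
    W: "\<forall>n. openin X (W n)" "\<forall>n. W (Suc n) \<subseteq> W n" "\<Inter> (range W) = A"
    using A unfolding gdelta_retract_def gdelta_in_descending by (elim conjE exE)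
  note W = W(1,2) [rule_format] W(3)
  obtain V where V: "stratification (subtopology X A) V"
    using stratifiable_imp_stratification [OF strat] by (elim exE)
  note nbhd = stratification_nbhd [OF V, unfolded topA]
    and dec = stratification_antimono [OF V, unfolded topA]
    and sep = stratification_separates [OF V]
  have preimage: "openin X {x \<in> topspace X. r x \<in> G}" if "openin (subtopology X A) G" for G
    using openin_continuous_map_preimage [OF r(1) that] .
  define U where "U n x = (if x \<in> A then {y \<in> W n. r y \<in> V n x} else {x})" for n x
  show ?thesis
  proof (rule stratifiable_spaceI [where U = U, OF t1])
    show "neighborhood_in X x (U n x)" if x: "x \<in> topspace X" for x n
    proof (cases "x \<in> A")
      case False
      then show ?thesis
        using iso x by (simp add: U_def neighborhood_in_singleton)
    next
      case True
      obtain G where G: "openin (subtopology X A) G" "x \<in> G" "G \<subseteq> V n x"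
        using nbhd [OF True] unfolding neighborhood_in_def by blast
      have "openin X (W n \<inter> {x \<in> topspace X. r x \<in> G})"
        using W(1) preimage [OF G(1)] by (rule openin_Int)
      moreover have "x \<in> W n"
        using W(3) True by blast
      ultimately show ?thesis
        unfolding neighborhood_in_def
        using True x G(2,3) r(2) [OF True] openin_subset [OF W(1) [of n]]
        by (intro conjI exI [of _ "W n \<inter> {x \<in> topspace X. r x \<in> G}"]) (auto simp: U_def)
    qed
    show "U (Suc n) x \<subseteq> U n x" for x n
      using dec [of x n "Suc n"] W(2) [of n] by (auto simp: U_def)
    fix F y assume F: "closedin X F" and y: "y \<in> topspace X - F"
    show "\<exists>n. y \<notin> X closure_of (\<Union>x\<in>F. U n x)"
    proof (cases "y \<in> A")
      case False
      \<comment> \<open>For \<open>x \<in> A\<close> the set \<open>U n x\<close> lies in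
        \<open>W n\<close> and misses \<open>y\<close>; for the other \<open>x \<in> F\<close> it is
        \<open>{x}\<close>, and \<open>y \<notin> F\<close>. Since \<open>{y}\<close> is open,
        missing the union means missing its closure.\<close>
      then obtain n where "y \<notin> W n"
        using W(3) by blast
      then have "y \<notin> (\<Union>x\<in>F. U n x)"
        using y by (auto simp: U_def split: if_splits)
      then have "y \<notin> X closure_of (\<Union>x\<in>F. U n x)"
        using iso [of y] False y by (auto simp: in_closure_of intro: exI [of _ "{y}"])
      then show ?thesis ..
    next
      case True
      have "closedin (subtopology X A) (F \<inter> A)"
        using F by (auto simp: closedin_subtopology)
      then obtain n where n: "y \<notin> subtopology X A closure_of (\<Union>x\<in>F \<inter> A. V n x)"
        using sep y by blast
      \<comment> \<open>The neighborhood of \<open>y = r y\<close> is the preimage of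
        \<open>G\<close> minus \<open>F\<close>: the preimage avoids \<open>U n x\<close> for
        \<open>x \<in> F \<inter> A\<close>, and removing \<open>F\<close> avoids the singletons
        \<open>U n x\<close> for the remaining \<open>x \<in> F\<close>.\<close>
      define G where "G = A - subtopology X A closure_of (\<Union>x\<in>F \<inter> A. V n x)"
      have "openin (subtopology X A) G"
        unfolding G_def by (metis topA closedin_closure_of openin_diff openin_topspace)
      then have "openin X ((topspace X - F) \<inter> {x \<in> topspace X. r x \<in> G})"
        using F preimage by (intro openin_Int) auto
      moreover have "y \<in> (topspace X - F) \<inter> {x \<in> topspace X. r x \<in> G}"
        using y n True by (simp add: G_def r(2))
      moreover have "z \<notin> (topspace X - F) \<inter> {x \<in> topspace X. r x \<in> G}"
        if z: "z \<in> U n x" and x: "x \<in> F" for z x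
      proof (cases "x \<in> A")
        case False
        then show ?thesis
          using z x by (simp add: U_def)
      next
        case True
        then have "r z \<in> V n x"
          using z by (simp add: U_def)
        moreover have "V n x \<subseteq> A"
          using nbhd [OF True, of n] AX by (simp add: neighborhood_in_def)
        ultimately have "r z \<in> topspace (subtopology X A) \<inter> (\<Union>x\<in>F \<inter> A. V n x)"
          using x True unfolding topA by blast
        then have "r z \<in> subtopology X A closure_of (\<Union>x\<in>F \<inter> A. V n x)"
          by (rule subsetD [OF closure_of_subset_Int])
        then have "r z \<notin> G"
          by (simp add: G_def)
        then show ?thesis
          by simp
      qed
      ultimately have "y \<notin> X closure_of (\<Union>x\<in>F. U n x)"
        unfolding in_closure_of by (metis (no_types, lifting) UN_E)
      then show ?thesis ..
    qed
  qed
qed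

section \<open>Scattered spaces and their finite derivatives\<close>

lemma scattered_imp_t1_space:
  assumes "scattered_space X"
  shows "t1_space X"
  unfolding t1_space_def
proof (intro ballI impI)
  fix x y assume xy: "x \<in> topspace X" "y \<in> topspace X" "x \<noteq> y"
  let ?Y = "subtopology X {x, y}"
  have top: "topspace ?Y = {x, y}"
    using xy by auto
  have "{x, y} \<subseteq> topspace X \<and> {x, y} \<noteq> {}"
    using xy by simp
  then obtain z where "isolated_point ?Y z"
    using assms unfolding scattered_space_def by presburger
  then have z: "z \<in> {x, y}" "openin ?Y {z}" "closedin ?Y {z}"
    unfolding isolated_point_def top by simp_all
  \<comment> \<open>The isolated point of the two-point subspace may be \<open>y\<close>; then
    closedness of \<open>{y}\<close> makes its complement \<open>{x}\<close> open.\<close>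
  have "openin ?Y {x}"
  proof (cases "z = x")
    case True
    with z show ?thesis
      by simp
  next
    case False
    then have "topspace ?Y - {z} = {x}"
      using z(1) xy(3) unfolding top by auto
    with z(3) show ?thesis
      by (simp only: closedin_def)
  qed
  then obtain U where U: "openin X U" "{x} = U \<inter> {x, y}"
    unfolding openin_subtopology by (elim exE conjE)
  then have "x \<in> U" "y \<notin> U"
    using xy(3) by auto
  with U(1) show "\<exists>U. openin X U \<and> x \<in> U \<and> y \<notin> U"
    by (intro exI [of _ U] conjI)
qed

lemma cb_derivative_0: "cb_derivative X 0 = topspace X"
  by (simp add: cb_derivative.simps)

text \<open>Recovers one-step recursion from the intersection over all earlier stages: every factor
  with \<open>k < n\<close> already contains \<open>cb_derivative X n\<close>, hence also the factor
  with \<open>k = n\<close>, which therefore equals the intersection.\<close>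

lemma cb_derivative_Suc:
  "cb_derivative X (Suc n) = nonisolated_points (subtopology X (cb_derivative X n))"
proof -
  have sub: "nonisolated_points (subtopology X (cb_derivative X n)) \<subseteq> cb_derivative X n" for n
    by (auto simp: nonisolated_points_def)
  have unfold: "cb_derivative X m =
      (\<Inter>k<m. nonisolated_points (subtopology X (cb_derivative X k)))" if "m \<noteq> 0" for m
    using that by (subst cb_derivative.simps) simp
  have "cb_derivative X n \<subseteq> nonisolated_points (subtopology X (cb_derivative X k))" if "k < n" for k
    using that unfold [of n] by auto
  then have "nonisolated_points (subtopology X (cb_derivative X n))
      \<subseteq> (\<Inter>k<n. nonisolated_points (subtopology X (cb_derivative X k)))"
    using sub [of n] by (intro INT_greatest) (simp add: subset_trans)
  then show ?thesis
    using unfold [of "Suc n"] by (simp add: lessThan_Suc inf.absorb1)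
qed

lemma cb_derivative_Suc_subset: "cb_derivative X (Suc n) \<subseteq> cb_derivative X n"
  unfolding cb_derivative_Suc by (auto simp: nonisolated_points_def)

lemma cb_derivative_subset_topspace: "cb_derivative X n \<subseteq> topspace X"
proof (induction n)
  case 0
  show ?case
    by (simp add: cb_derivative_0)
next
  case (Suc n)
  with cb_derivative_Suc_subset show ?case
    by (rule subset_trans)
qed

lemma topspace_cb_derivative:
  "topspace (subtopology X (cb_derivative X n)) = cb_derivative X n"
  by (simp add: cb_derivative_subset_topspace inf.absorb2)

lemma openin_cb_derivative_singleton:
  assumes "x \<in> cb_derivative X n - cb_derivative X (Suc n)"
  shows "openin (subtopology X (cb_derivative X n)) {x}"
  using assms
  by (simp add: cb_derivative_Suc nonisolated_points_def isolated_point_def topspace_cb_derivative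
      del: topspace_subtopology)

text \<open>The points removed at a stage are isolated there, so they form a union of open
  singletons.\<close>

lemma closedin_cb_derivative_Suc:
  "closedin (subtopology X (cb_derivative X n)) (cb_derivative X (Suc n))"
proof -
  let ?Y = "subtopology X (cb_derivative X n)"
  have "openin ?Y (\<Union>x\<in>cb_derivative X n - cb_derivative X (Suc n). {x})"
    by (rule openin_Union) (auto intro: openin_cb_derivative_singleton)
  then show ?thesis
    unfolding closedin_def topspace_cb_derivative using cb_derivative_Suc_subset [of X n] by simp
qed

lemma closedin_cb_derivative: "closedin X (cb_derivative X n)"
proof (induction n)
  case 0
  show ?case
    by (simp add: cb_derivative_0)
next
  case (Suc n)
  with closedin_cb_derivative_Suc show ?case
    by (rule closedin_trans_full)
qed

text \<open>A nonempty derivative has an isolated point, which the next stage drops. Hence the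
  height is the first index with empty derivative.\<close>

lemma scattered_cb_derivative_stable_iff:
  assumes "scattered_space X"
  shows "cb_derivative X n = cb_derivative X (Suc n) \<longleftrightarrow> cb_derivative X n = {}"
proof
  assume eq: "cb_derivative X n = cb_derivative X (Suc n)"
  show "cb_derivative X n = {}"
  proof (rule ccontr)
    assume "cb_derivative X n \<noteq> {}"
    then obtain x where x: "isolated_point (subtopology X (cb_derivative X n)) x"
      using assms [unfolded scattered_space_def, rule_format, of "cb_derivative X n"]
        cb_derivative_subset_topspace [of X n] by auto
    then have "x \<in> cb_derivative X (Suc n)"
      unfolding isolated_point_def topspace_cb_derivative eq [symmetric] by simp
    with x show False
      by (simp add: cb_derivative_Suc nonisolated_points_def)
  qed
next
  assume "cb_derivative X n = {}"
  then show "cb_derivative X n = cb_derivative X (Suc n)"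
    using cb_derivative_Suc_subset [of X n] by blast
qed

section \<open>Induction along the derivatives\<close>

theorem theorem13p2:
  fixes X :: "'a topology"
  assumes "scattered_space X"
    and "finite_scattered_height X"
  shows "stratifiable_space X \<longleftrightarrow>
    (\<forall>n<scattered_height X. gdelta_retract X (cb_derivative X n))"
proof
  let ?D = "cb_derivative X" and ?h = "scattered_height X"
  have step: "subtopology (subtopology X (?D n)) (?D (Suc n)) = subtopology X (?D (Suc n))" for n
    using cb_derivative_Suc_subset [of X n] by (simp add: subtopology_subtopology inf.absorb2)
  have nonempty: "?D n \<noteq> {}" if "n < ?h" for n
    using not_less_Least [OF that [unfolded scattered_height_def]]
    unfolding scattered_cb_derivative_stable_iff [OF assms(1)] .
  have empty: "?D ?h = {}"
    using LeastI_ex [OF assms(2) [unfolded finite_scattered_height_def]]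
    unfolding scattered_height_def scattered_cb_derivative_stable_iff [OF assms(1)] .
  show "\<forall>n<?h. gdelta_retract X (?D n)" if X: "stratifiable_space X"
  proof (intro allI impI)
    fix n assume "n < ?h"
    \<comment> \<open>Each derivative is a retract of the preceding one, and the retractions
      compose. Nonemptiness below the height supplies the values of the retraction.\<close>
    then have "?D n retract_of_space X"
    proof (induction n)
      case 0
      then show ?case
        by (simp add: cb_derivative_0 retract_of_space_topspace)
    next
      case (Suc n)
      have "?D (Suc n) retract_of_space subtopology X (?D n)"
      proof (rule stratifiable_imp_retract)
        show "stratifiable_space (subtopology X (?D n))"
          by (rule stratifiable_space_closed_subtopology [OF X closedin_cb_derivative])
        show "openin (subtopology X (?D n)) {x}"
          if "x \<in> topspace (subtopology X (?D n)) - ?D (Suc n)" for x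
          using that unfolding topspace_cb_derivative by (rule openin_cb_derivative_singleton)
      qed (rule closedin_cb_derivative_Suc, rule nonempty [OF Suc.prems])
      with Suc.IH [OF Suc_lessD [OF Suc.prems]] show ?case
        by (rule retract_of_space_trans)
    qed
    then show "gdelta_retract X (?D n)"
      by (simp add: gdelta_retract_def stratifiable_imp_gdelta_in [OF X closedin_cb_derivative])
  qed
  show "stratifiable_space X" if retr: "\<forall>n<?h. gdelta_retract X (?D n)"
  proof -
    have "stratifiable_space (subtopology X (?D 0))"
    \<comment> \<open>The induction descends from the empty stage \<open>?D ?h\<close> to the whole
      space \<open>?D 0\<close>.\<close>
    proof (rule inc_induct [of 0 ?h])
      show "stratifiable_space (subtopology X (?D ?h))"
        by (rule stratifiable_space_discrete) (simp add: empty)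
    next
      fix n assume n: "n < ?h" and IH: "stratifiable_space (subtopology X (?D (Suc n)))"
      have iso: "openin (subtopology X (?D n)) {x}"
        if "x \<in> topspace (subtopology X (?D n)) - ?D (Suc n)" for x
        using that unfolding topspace_cb_derivative by (rule openin_cb_derivative_singleton)
      show "stratifiable_space (subtopology X (?D n))"
      \<comment> \<open>The hypothesis stops below \<open>?h\<close>, and the empty
        \<open>?D ?h\<close> is no retract of the nonempty \<open>?D n\<close>. In this case
        \<open>?D n\<close> is discrete instead.\<close>
      proof (cases "Suc n = ?h")
        case True
        then show ?thesis
          using iso empty by (intro stratifiable_space_discrete) (simp del: topspace_subtopology)
      next
        case False
        then have "gdelta_retract X (?D (Suc n))"
          using retr n by simp
        then have "gdelta_retract (subtopology X (?D n)) (?D (Suc n))"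
          using cb_derivative_Suc_subset by (rule gdelta_retract_subtopology)
        with t1_space_subtopology [OF scattered_imp_t1_space [OF assms(1)]] show ?thesis
          using IH [folded step] iso by (rule gdelta_retract_imp_stratifiable)
      qed
    qed simp
    then show ?thesis
      by (simp add: cb_derivative_0)
  qed
qed

end
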